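(* For every integer $v\ge 3201$, we have $3v-5625\le m(v,2)\le 3v+25$, where $m(v,2)$ is the minimum number of edges of a $2$-e.c. graph on $v$ vertices.
   Context: All graphs are finite and simple. A graph $G$ is $n$-existentially closed ($n$-e.c.) if for all subsets $S\subseteq V(G)$ with $|S|=n$ and all partitions $S=A\sqcup B$ (with $A$ or $B$ possibly empty), there exists a vertex in $V(G)\setminus S$ adjacent to all vertices in $A$ and to no vertices in $B$. $m(v,n)$ denotes the minimum number of edges in an $n$-e.c. graph with $v$ vertices. *)

theory Defs
  imports Main "HOL-Library.Extended_Nat"
begin

definition simple_graph :: "'a set \<Rightarrow> 'a set set \<Rightarrow> bool" where
  "simple_graph V E \<longleftrightarrow> finite V \<and> E \<subseteq> {e. e \<subseteq> V \<and> card e = 2}"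

definition existentially_closed :: "nat \<Rightarrow> 'a set \<Rightarrow> 'a set set \<Rightarrow> bool" where
  "existentially_closed n V E \<longleftrightarrow>
     (\<forall>S A B. S \<subseteq> V \<and> card S = n \<and> A \<union> B = S \<and> A \<inter> B = {} \<longrightarrow>
        (\<exists>z \<in> V - S. (\<forall>a\<in>A. {z, a} \<in> E) \<and> (\<forall>b\<in>B. {z, b} \<notin> E)))"

(* Every finite graph is isomorphic to one whose vertices are natural numbers.
   The infimum in enat is an attained minimum if some n-e.c. graph on v vertices
   exists, and infinity otherwise; so a finite upper bound entails existence. *)
definition min_ec_edges :: "nat \<Rightarrow> nat \<Rightarrow> enat" where
  "min_ec_edges v n =
     Inf {enat (card E) | (V :: nat set) E.
            simple_graph V E \<and> card V = v \<and> existentially_closed n V E}"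

end

theory Submission
  imports Defs
begin

text \<open>
  Lower bound. Call a vertex a hub if its degree is at least \<open>v / 13\<close>; a graph with fewer than
  \<open>3 v\<close> edges has boundedly many hubs. For a bounded set \<open>H\<close> of vertices containing the hubs, twice the
  number of edges is at least the sum of \<open>d(x) + d\<^sub>H(x)\<close> over \<open>x \<notin> H\<close>, so it is enough that these
  terms average at least 6. All degrees are at least 4, and neighbourhoods dominate the graph, so a
  term falls below 6 only for the poor vertices \<open>u\<close>, of degree 4 with a single neighbour \<open>h\<close> in \<open>H\<close>; then
  \<open>h\<close> is adjacent to almost everything, which leaves at most three possible \<open>h\<close>. The missing unit is
  charged to a neighbour \<open>c\<close> of \<open>u\<close> that is not adjacent to \<open>h\<close>. A vertex \<open>p\<close> that cannot pay has few
  neighbours other than poor vertices charging it, and it shares a neighbour outside \<open>H\<close> with each of the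
  poor vertices in question; hence \<open>p\<close> or one of its neighbours is adjacent to a fixed proportion of
  them. Boundedly many vertices are, and adding them to \<open>H\<close> increases \<open>d\<^sub>H(p)\<close>. After three rounds every
  remaining vertex can pay.

  Upper bound. Take three independent hubs and a cycle on the remaining vertices, coloured with the
  three hubs so that vertices at distance two on the cycle differ in colour; join each cycle
  vertex to the two hubs other than its colour. This has \<open>3 (v - 3)\<close> edges.
\<close>

section \<open>Degrees and neighbourhoods in 2-e.c. graphs\<close>

locale ec2_graph =
  fixes V :: "'a set" and E :: "'a set set"
  assumes simple: "simple_graph V E"
    and ec2: "existentially_closed 2 V E"
    and two_le_card: "2 \<le> card V"
begin

definition nb :: "'a \<Rightarrow> 'a set" where
  "nb x = {y. {x, y} \<in> E}"

lemma finite_V [simp]: "finite V"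
  using simple by (simp add: simple_graph_def)

lemma edgeD: "e \<in> E \<Longrightarrow> e \<subseteq> V \<and> card e = 2"
  using simple by (auto simp: simple_graph_def)

lemma finite_E [simp]: "finite E"
  by (rule finite_subset[of _ "Pow V"]) (auto dest: edgeD)

lemma nb_sym: "x \<in> nb y \<longleftrightarrow> y \<in> nb x"
  by (simp add: nb_def insert_commute)

lemma nb_subset: "nb x \<subseteq> V"
  using edgeD by (auto simp: nb_def)

lemma finite_nb [simp]: "finite (nb x)"
  using nb_subset finite_V finite_subset by blast

lemma nb_irrefl [simp]: "x \<notin> nb x"
  using edgeD[of "{x}"] by (auto simp: nb_def)

lemma sum_degrees: "(\<Sum>x\<in>V. card (nb x)) = 2 * card E"
proof -
  have "card (nb x) = card {e \<in> E. x \<in> e}" for x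
  proof (rule bij_betw_same_card[of "\<lambda>y. {x, y}"], rule bij_betw_imageI)
    show "inj_on (\<lambda>y. {x, y}) (nb x)"
      by (auto simp: inj_on_def doubleton_eq_iff)
    show "(\<lambda>y. {x, y}) ` nb x = {e \<in> E. x \<in> e}"
    proof (intro equalityI subsetI)
      fix e assume e: "e \<in> {e \<in> E. x \<in> e}"
      then obtain a b where "e = {a, b}"
        using edgeD[of e] by (auto simp: card_2_iff)
      with e show "e \<in> (\<lambda>y. {x, y}) ` nb x"
        by (auto simp: nb_def insert_commute)
    qed (auto simp: nb_def)
  qed
  moreover have "(\<Sum>x\<in>V. card {e \<in> E. x \<in> e}) = 2 * card E"
  proof (rule sum_multicount)
    show "\<forall>e\<in>E. card {x \<in> V. x \<in> e} = 2"
    proof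
      fix e assume "e \<in> E"
      then have "{x \<in> V. x \<in> e} = e" "card e = 2"
        using edgeD[of e] by auto
      then show "card {x \<in> V. x \<in> e} = 2" by simp
    qed
  qed auto
  ultimately show ?thesis by simp
qed

lemma sum_nb_swap:
  assumes "A \<subseteq> V" "B \<subseteq> V"
  shows "(\<Sum>x\<in>A. card (nb x \<inter> B)) = (\<Sum>x\<in>B. card (nb x \<inter> A))"
proof -
  have fin: "finite A" "finite B"
    using assms finite_subset[OF _ finite_V] by auto
  have card_eq: "card (nb x \<inter> C) = (\<Sum>y\<in>C. if y \<in> nb x then 1 else 0)" if "finite C" for x C
    using that by (subst sum.inter_restrict[symmetric]) (auto simp: Int_commute)
  show ?thesis
    unfolding card_eq[OF fin(1)] card_eq[OF fin(2)]
    by (subst sum.swap) (simp add: nb_sym)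
qed

text \<open>Counted from the other side, the edges between \<open>H\<close> and its complement
  number at most the degree sum over \<open>H\<close>, so the total stays within the degree sum of
  the graph.\<close>

lemma edge_bound:
  assumes "H \<subseteq> V"
  shows "(\<Sum>x\<in>V - H. card (nb x) + card (nb x \<inter> H)) \<le> 2 * card E"
proof -
  have "(\<Sum>x\<in>V - H. card (nb x \<inter> H)) = (\<Sum>x\<in>H. card (nb x \<inter> (V - H)))"
    using assms by (intro sum_nb_swap) auto
  also have "\<dots> \<le> (\<Sum>x\<in>H. card (nb x))"
    by (intro sum_mono card_mono) auto
  finally have "(\<Sum>x\<in>V - H. card (nb x) + card (nb x \<inter> H)) \<le> (\<Sum>x\<in>V - H. card (nb x)) + (\<Sum>x\<in>H. card (nb x))"
    by (simp add: sum.distrib)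
  also have "\<dots> = 2 * card E"
    using assms by (simp add: sum_degrees[symmetric] sum.subset_diff[of H V])
  finally show ?thesis .
qed

lemma common_nb:
  assumes "x \<in> V" "y \<in> V" "x \<noteq> y"
  obtains z where "z \<in> nb x" "z \<in> nb y"
proof -
  have "\<exists>z\<in>V - {x, y}. (\<forall>a\<in>{x, y}. {z, a} \<in> E) \<and> (\<forall>b\<in>{}. {z, b} \<notin> E)"
    by (rule ec2[unfolded existentially_closed_def, rule_format]) (use assms in auto)
  then show ?thesis using that by (auto simp: nb_def insert_commute)
qed

lemma private_nb:
  assumes "x \<in> V" "y \<in> V" "x \<noteq> y"
  obtains z where "z \<in> nb x" "z \<noteq> y" "z \<notin> nb y"
proof -
  have "\<exists>z\<in>V - {x, y}. (\<forall>a\<in>{x}. {z, a} \<in> E) \<and> (\<forall>b\<in>{y}. {z, b} \<notin> E)"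
    by (rule ec2[unfolded existentially_closed_def, rule_format]) (use assms in auto)
  then show ?thesis using that by (auto simp: nb_def insert_commute)
qed

lemma nb_nonempty:
  assumes "x \<in> V"
  shows "nb x \<noteq> {}"
proof -
  have "\<not> V \<subseteq> {x}"
    using two_le_card card_mono[of "{x}" V] by auto
  then obtain y where "y \<in> V" "x \<noteq> y" by auto
  then show ?thesis using common_nb[OF assms] by blast
qed

text \<open>Within \<open>nb x\<close> every vertex has a neighbour and also a non-neighbour other
  than itself; a nonempty graph on at most three vertices cannot have both properties.\<close>

lemma four_le_degree:
  assumes x: "x \<in> V"
  shows "4 \<le> card (nb x)"
proof -
  obtain y where y: "y \<in> nb x" using nb_nonempty[OF x] by auto
  have in_V: "w \<in> V \<and> x \<noteq> w" if "w \<in> nb x" for w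
    using that nb_subset[of x] nb_irrefl[of x] by blast
  obtain a where a: "a \<in> nb x" "a \<in> nb y" using common_nb[of x y] x in_V[OF y] by blast
  obtain b where b: "b \<in> nb x" "b \<noteq> y" "b \<notin> nb y" using private_nb[of x y] x in_V[OF y] by blast
  obtain c where c: "c \<in> nb x" "c \<in> nb b" using common_nb[of x b] x in_V[OF b(1)] by blast
  obtain d where d: "d \<in> nb x" "d \<noteq> a" "d \<notin> nb a" using private_nb[of x a] x in_V[OF a(1)] by blast
  have "\<exists>S\<subseteq>nb x. card S = 4"
  \<comment> \<open>If \<open>c = a\<close>, then \<open>a\<close> is adjacent to both
    \<open>y\<close> and \<open>b\<close>, so its non-neighbour \<open>d\<close> is a fourth vertex;
    otherwise \<open>c\<close> is.\<close>
  proof (cases "c = a")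
    case True
    then have "d \<noteq> y" "d \<noteq> b" using a b c d nb_sym by blast+
    moreover have "a \<noteq> y" "a \<noteq> b" using a b by auto
    ultimately show ?thesis using y a b d by (intro exI[of _ "{y, a, b, d}"]) auto
  next
    case False
    moreover have "a \<noteq> y" "a \<noteq> b" "c \<noteq> b" "c \<noteq> y" using a b c nb_sym by auto
    ultimately show ?thesis using y a b c by (intro exI[of _ "{y, a, b, c}"]) auto
  qed
  then show ?thesis using card_mono[OF finite_nb] by metis
qed

lemma nb_dominates:
  assumes "x \<in> V"
  shows "card V \<le> (\<Sum>y\<in>nb x. card (nb y))"
proof -
  have "V \<subseteq> (\<Union>y\<in>nb x. nb y)"
  proof
    fix z assume "z \<in> V"
    show "z \<in> (\<Union>y\<in>nb x. nb y)"
    proof (cases "z = x")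
      case True
      then show ?thesis using nb_nonempty[OF assms] nb_sym by blast
    next
      case False
      then show ?thesis using common_nb[OF assms \<open>z \<in> V\<close>] nb_sym by blast
    qed
  qed
  then have "card V \<le> card (\<Union>y\<in>nb x. nb y)" by (intro card_mono) auto
  also have "\<dots> \<le> (\<Sum>y\<in>nb x. card (nb y))" by (rule card_UN_le) simp
  finally show ?thesis .
qed

end

section \<open>Hubs and nearly dominating vertices in a sparse graph\<close>

locale sparse_ec2_graph = ec2_graph +
  assumes large: "200 \<le> card V"
    and sparse: "card E < 3 * card V"
begin

text \<open>The divisor 13 leaves room for \<open>12 * k + 12\<close> vertices, which the count of
  four major vertices in \<open>card_major\<close> requires.\<close>

definition k :: nat where
  "k = card V div 13"

lemma k_bounds: "12 * k + 12 \<le> card V" "card V \<le> 13 * k + 12" "13 \<le> k"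
  using large unfolding k_def by linarith+

definition hubs :: "'a set" where
  "hubs = {x \<in> V. k \<le> card (nb x)}"

text \<open>The three non-hub neighbours of a poor vertex cover at most \<open>3 * k\<close>
  vertices; its hub has to cover all the others.\<close>

definition major :: "'a set" where
  "major = {x \<in> V. card V \<le> card (nb x) + 3 * k}"

lemma hubs_subset: "hubs \<subseteq> V"
  by (auto simp: hubs_def)

lemma major_subset: "major \<subseteq> V"
  by (auto simp: major_def)

lemma finite_major [simp]: "finite major"
  by (rule finite_subset[OF major_subset finite_V])

lemma card_hubs: "card hubs \<le> 84"
proof -
  have "card hubs * k = (\<Sum>x\<in>hubs. k)" by simp
  also have "\<dots> \<le> (\<Sum>x\<in>hubs. card (nb x))"
    by (rule sum_mono) (simp add: hubs_def)
  also have "\<dots> \<le> (\<Sum>x\<in>V. card (nb x))"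
    by (rule sum_mono2) (use hubs_subset in auto)
  finally have "card hubs * k < 6 * card V"
    using sparse by (simp add: sum_degrees)
  \<comment> \<open>This is \<open>6 * (13 * k + 12) \<le> 84 * k\<close>, true once
    \<open>12 \<le> k\<close>.\<close>
  also have "\<dots> \<le> 84 * k" using k_bounds by simp
  finally show ?thesis by simp
qed

text \<open>Four such vertices, each with at most 3 neighbours among the others, would send at least
  \<open>4 * card V - 4 * (3 * k + 3)\<close> edges out of their set. This is at least
  \<open>3 * card V\<close>, against sparsity.\<close>

lemma card_major: "card major \<le> 3"
proof (rule ccontr)
  assume "\<not> card major \<le> 3"
  then have "4 \<le> card major" by simp
  then obtain S where S: "S \<subseteq> major" "card S = 4" "finite S"
    by (rule obtain_subset_with_card_n)
  have SV: "S \<subseteq> V" using S major_subset by auto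
  have deg: "card V \<le> card (nb h \<inter> (V - S)) + 3 * k + 3" if "h \<in> S" for h
  proof -
    have "card (nb h) \<le> card ((nb h \<inter> (V - S)) \<union> (S - {h}))"
      by (rule card_mono) (use S nb_subset[of h] in \<open>auto simp: nb_irrefl\<close>)
    also have "\<dots> \<le> card (nb h \<inter> (V - S)) + card (S - {h})"
      by (rule card_Un_le)
    also have "card (S - {h}) = 3" using S that by simp
    finally show ?thesis using that S by (auto simp: major_def)
  qed
  have "4 * card V = (\<Sum>h\<in>S. card V)" using S by simp
  also have "\<dots> \<le> (\<Sum>h\<in>S. card (nb h \<inter> (V - S)) + (3 * k + 3))"
    using deg by (intro sum_mono) (simp add: add.assoc)
  also have "\<dots> = (\<Sum>x\<in>V - S. card (nb x \<inter> S)) + 4 * (3 * k + 3)"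
    using S SV by (simp add: sum.distrib sum_nb_swap[of S "V - S"])
  finally have "4 * card V \<le> (\<Sum>x\<in>V - S. card (nb x \<inter> S)) + card V"
    using k_bounds by simp
  moreover have "2 * (\<Sum>x\<in>V - S. card (nb x \<inter> S)) \<le> (\<Sum>x\<in>V - S. card (nb x) + card (nb x \<inter> S))"
    unfolding sum_distrib_left by (rule sum_mono) (simp add: mult_2 card_mono)
  ultimately show False using edge_bound[OF SV] sparse by simp
qed

lemma degree_nonhub:
  assumes "x \<in> V" "x \<notin> hubs"
  shows "card (nb x) < k"
  using assms by (simp add: hubs_def)

text \<open>Five neighbourhoods of fewer than \<open>k\<close> vertices each cannot cover the
  graph.\<close>

lemma no_hub_degree:
  assumes "x \<in> V" "nb x \<inter> hubs = {}"
  shows "6 \<le> card (nb x)"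
proof (rule ccontr)
  assume "\<not> 6 \<le> card (nb x)"
  then have deg: "card (nb x) \<le> 5" by simp
  have "card V \<le> (\<Sum>y\<in>nb x. card (nb y))" by (rule nb_dominates[OF assms(1)])
  also have "\<dots> \<le> (\<Sum>y\<in>nb x. k)"
    using assms nb_subset[of x] degree_nonhub by (intro sum_mono) (blast intro: less_imp_le)
  also have "\<dots> \<le> 5 * k" using deg by simp
  finally show False using k_bounds by simp
qed

section \<open>Poor, heavy and debtor vertices\<close>

text \<open>
  \<open>debtors H\<close> are the vertices that cannot pay, \<open>major - nb p\<close> being the hubs \<open>h\<close> whose poor vertices
  may charge \<open>p\<close>, and \<open>heavy H R\<close> the vertices adjacent to at least a seventh of \<open>poor H R\<close>.
\<close>

definition poor :: "'a set \<Rightarrow> 'a set \<Rightarrow> 'a set" where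
  "poor H R = {u \<in> V - H. card (nb u) = 4 \<and> (\<exists>h\<in>R. nb u \<inter> H = {h})}"

definition debtors :: "'a set \<Rightarrow> 'a set" where
  "debtors H = {p \<in> V - H. nb p \<inter> poor H (major - nb p) \<noteq> {} \<and>
     2 * card (nb p \<inter> H) + card (nb p - H - poor H (major - nb p)) < 6}"

definition heavy :: "'a set \<Rightarrow> 'a set \<Rightarrow> 'a set" where
  "heavy H R = {t \<in> V - H. poor H R \<noteq> {} \<and> card (poor H R) \<le> 7 * card (nb t \<inter> poor H R)}"

text \<open>The set \<open>major - nb p\<close> in \<open>debtors\<close> depends on
  \<open>p\<close>. Ranging over all subsets of \<open>major\<close> serves every \<open>p\<close>
  at once, and there are at most eight of them.\<close>

definition grow :: "'a set \<Rightarrow> 'a set" where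
  "grow H = H \<union> (\<Union>R\<in>Pow major. heavy H R)"

lemma poor_subset: "poor H R \<subseteq> V - H"
  by (auto simp: poor_def)

lemma finite_poor [simp]: "finite (poor H R)"
  using poor_subset[of H R] finite_subset[of _ V] by auto

lemma card_poor_nb:
  assumes "u \<in> poor H R"
  shows "card (nb u - H) = 3"
proof -
  obtain h where "nb u \<inter> H = {h}" "card (nb u) = 4" using assms by (auto simp: poor_def)
  moreover have "card (nb u) = card (nb u \<inter> H) + card (nb u - H)"
    by (metis card_Int_Diff finite_nb)
  ultimately show ?thesis by simp
qed

text \<open>Double counting: a heavy vertex meets at least a seventh of the poor ones, while each
  poor vertex has only three neighbours outside \<open>H\<close>.\<close>

lemma card_heavy: "card (heavy H R) \<le> 21"
proof (cases "poor H R = {}")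
  case False
  let ?U = "poor H R"
  have "card (heavy H R) * card ?U = (\<Sum>t\<in>heavy H R. card ?U)" by simp
  also have "\<dots> \<le> (\<Sum>t\<in>heavy H R. 7 * card (nb t \<inter> ?U))"
    by (rule sum_mono) (simp add: heavy_def)
  also have "\<dots> = 7 * (\<Sum>u\<in>?U. card (nb u \<inter> heavy H R))"
    using poor_subset[of H R]
    by (subst sum_nb_swap[symmetric]) (auto simp: sum_distrib_left heavy_def)
  also have "\<dots> \<le> 7 * (\<Sum>u\<in>?U. 3)"
  proof (intro mult_left_mono sum_mono)
    fix u assume "u \<in> ?U"
    then have "card (nb u - H) = 3" by (rule card_poor_nb)
    moreover have "card (nb u \<inter> heavy H R) \<le> card (nb u - H)"
      by (rule card_mono) (auto simp: heavy_def)
    ultimately show "card (nb u \<inter> heavy H R) \<le> 3" by simp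
  qed simp
  finally have "card (heavy H R) * card ?U \<le> 21 * card ?U" by simp
  moreover have "0 < card ?U" using False by (simp add: card_gt_0_iff)
  ultimately show ?thesis by simp
qed (simp add: heavy_def)

lemma grow_subset: "H \<subseteq> V \<Longrightarrow> grow H \<subseteq> V"
  by (auto simp: grow_def heavy_def)

lemma subset_grow: "H \<subseteq> grow H"
  by (auto simp: grow_def)

lemma card_grow: "card (grow H) \<le> card H + 168"
proof -
  have "card (\<Union>R\<in>Pow major. heavy H R) \<le> (\<Sum>R\<in>Pow major. card (heavy H R))"
    by (rule card_UN_le) simp
  also have "\<dots> \<le> (\<Sum>R\<in>Pow major. 21)"
    by (rule sum_mono) (rule card_heavy)
  also have "\<dots> = 2 ^ card major * 21" by (simp add: card_Pow)
  also have "\<dots> \<le> 2 ^ 3 * 21"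
    using card_major by (intro mult_right_mono power_increasing) auto
  also have "\<dots> = 168" by simp
  finally show ?thesis
    unfolding grow_def using card_Un_le[of H "\<Union>R\<in>Pow major. heavy H R"] by linarith
qed

text \<open>Each poor \<open>u\<close> shares a neighbour \<open>z\<close> with \<open>p\<close>,
  and \<open>z\<close> is outside \<open>H\<close> because the only neighbour of \<open>u\<close> in
  \<open>H\<close> lies in \<open>R\<close>. If \<open>z\<close> is itself poor, \<open>p\<close> is
  one of its three neighbours outside \<open>H\<close>, so it reaches only two such
  \<open>u\<close>.\<close>

lemma poor_reach:
  assumes p: "p \<in> V - H" and R: "nb p \<inter> R = {}"
  shows "card (poor H R) \<le> (\<Sum>s\<in>nb p - H - poor H R. card (nb s \<inter> poor H R)) + 2 * card (nb p \<inter> poor H R)"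
proof -
  let ?U = "poor H R"
  let ?S = "nb p - H - ?U"
  have "?U \<subseteq> (\<Union>s\<in>?S. nb s \<inter> ?U) \<union> (\<Union>d\<in>nb p \<inter> ?U. nb d - H - {p})"
  proof
    fix u assume u: "u \<in> ?U"
    then obtain h where h: "h \<in> R" "nb u \<inter> H = {h}" by (auto simp: poor_def)
    then have "u \<noteq> p" using R by auto
    then obtain z where z: "z \<in> nb p" "z \<in> nb u"
      using common_nb[of p u] p u poor_subset[of H R] by blast
    then have "z \<notin> H" using h R by auto
    moreover have "u \<in> nb z" "u \<notin> H" using z u nb_sym by (auto simp: poor_def)
    ultimately show "u \<in> (\<Union>s\<in>?S. nb s \<inter> ?U) \<union> (\<Union>d\<in>nb p \<inter> ?U. nb d - H - {p})"
      using z u \<open>u \<noteq> p\<close> by blast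
  qed
  then have "card ?U \<le> card ((\<Union>s\<in>?S. nb s \<inter> ?U) \<union> (\<Union>d\<in>nb p \<inter> ?U. nb d - H - {p}))"
    by (intro card_mono) auto
  also have "\<dots> \<le> card (\<Union>s\<in>?S. nb s \<inter> ?U) + card (\<Union>d\<in>nb p \<inter> ?U. nb d - H - {p})"
    by (rule card_Un_le)
  also have "\<dots> \<le> (\<Sum>s\<in>?S. card (nb s \<inter> ?U)) + (\<Sum>d\<in>nb p \<inter> ?U. card (nb d - H - {p}))"
    by (intro add_mono card_UN_le) auto
  also have "(\<Sum>d\<in>nb p \<inter> ?U. card (nb d - H - {p})) = (\<Sum>d\<in>nb p \<inter> ?U. 2)"
  proof (rule sum.cong)
    fix d assume d: "d \<in> nb p \<inter> ?U"
    then have "p \<in> nb d - H" using p nb_sym by blast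
    then show "card (nb d - H - {p}) = 2" using card_poor_nb[of d H R] d by simp
  qed simp
  finally show ?thesis by simp
qed

text \<open>This is where the seventh comes from. If \<open>p\<close> and its neighbours outside
  \<open>H\<close> were all light, the at most five non-poor ones would reach at most 5/7 of the
  poor vertices, and the poor ones, via \<open>poor_reach\<close>, strictly less than 2/7.\<close>

lemma debtor_nb_heavy:
  assumes p: "p \<in> debtors H" "p \<notin> grow H"
  shows "nb p \<inter> (grow H - H) \<noteq> {}"
proof
  assume none: "nb p \<inter> (grow H - H) = {}"
  define R where "R = major - nb p"
  let ?U = "poor H R"
  let ?S = "nb p - H - ?U"
  have pV: "p \<in> V - H" and U: "?U \<noteq> {}" "nb p \<inter> ?U \<noteq> {}" and S: "card ?S \<le> 5"
    using p by (auto simp: debtors_def R_def)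
  have light: "7 * card (nb t \<inter> ?U) + 1 \<le> card ?U" if "t \<in> V - H" "t \<notin> grow H" for t
    using that U by (auto simp: grow_def heavy_def R_def)
  have "7 * card ?U \<le> (\<Sum>s\<in>?S. 7 * card (nb s \<inter> ?U)) + 2 * (7 * card (nb p \<inter> ?U))"
    using poor_reach[OF pV, of R] by (auto simp: R_def sum_distrib_left[symmetric])
  also have "(\<Sum>s\<in>?S. 7 * card (nb s \<inter> ?U)) \<le> (\<Sum>s\<in>?S. card ?U)"
  proof (rule sum_mono)
    fix s assume "s \<in> ?S"
    then have "s \<in> V - H" "s \<notin> grow H" using none nb_subset[of p] by auto
    then show "7 * card (nb s \<inter> ?U) \<le> card ?U" using light[of s] by simp
  qed
  also have "\<dots> \<le> 5 * card ?U" using S by simp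
  finally show False using light[OF pV p(2)] by linarith
qed

text \<open>The single neighbour in \<open>H'\<close> is not lost on passing to \<open>H\<close>: a
  vertex of degree 4 has a hub neighbour, and the hubs lie in \<open>H\<close>.\<close>

lemma poor_antimono:
  assumes "hubs \<subseteq> H" "H \<subseteq> H'"
  shows "poor H' R \<subseteq> poor H R"
proof
  fix u assume u: "u \<in> poor H' R"
  then obtain h where "h \<in> R" "nb u \<inter> H' = {h}" by (auto simp: poor_def)
  moreover have "nb u \<inter> hubs \<noteq> {}"
    using no_hub_degree[of u] u by (auto simp: poor_def)
  moreover have "nb u \<inter> hubs \<subseteq> nb u \<inter> H" "nb u \<inter> H \<subseteq> nb u \<inter> H'" using assms by auto
  ultimately have "nb u \<inter> H = {h}" by auto
  then show "u \<in> poor H R" using u \<open>h \<in> R\<close> assms by (auto simp: poor_def)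
qed

text \<open>The quantity bounded in \<open>debtors\<close> never decreases as \<open>H\<close>
  grows: a neighbour absorbed into \<open>H\<close> counts two instead of at most one, and no other
  vertex becomes poor. So \<open>p\<close> was a debtor before, and \<open>debtor_nb_heavy\<close>
  supplies an absorbed neighbour.\<close>

lemma debtors_grow:
  assumes H: "hubs \<subseteq> H" and p: "p \<in> debtors (grow H)"
  shows "p \<in> debtors H \<and> card (nb p \<inter> H) < card (nb p \<inter> grow H)"
proof -
  define R where "R = major - nb p"
  let ?H = "grow H"
  have sub: "poor ?H R \<subseteq> poor H R" by (rule poor_antimono[OF H subset_grow])
  have pV: "p \<in> V - ?H" and U: "nb p \<inter> poor ?H R \<noteq> {}"
    and lt: "2 * card (nb p \<inter> ?H) + card (nb p - ?H - poor ?H R) < 6"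
    using p by (auto simp: debtors_def R_def)
  have "card (nb p - H - poor H R) \<le> card ((nb p \<inter> (?H - H)) \<union> (nb p - ?H - poor ?H R))"
    using sub by (intro card_mono) auto
  also have "\<dots> \<le> card (nb p \<inter> (?H - H)) + card (nb p - ?H - poor ?H R)"
    by (rule card_Un_le)
  finally have le: "card (nb p - H - poor H R) \<le> card (nb p \<inter> (?H - H)) + card (nb p - ?H - poor ?H R)" .
  have "nb p \<inter> ?H = (nb p \<inter> H) \<union> (nb p \<inter> (?H - H))" using subset_grow by blast
  then have split: "card (nb p \<inter> ?H) = card (nb p \<inter> H) + card (nb p \<inter> (?H - H))"
    by (simp, subst card_Un_disjoint[symmetric]) auto
  have d: "p \<in> debtors H"
    using pV U lt le split sub subset_grow[of H] by (auto simp: debtors_def R_def)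
  have "card (nb p \<inter> (?H - H)) > 0"
    using debtor_nb_heavy[OF d] pV by (subst card_gt_0_iff) auto
  with d split show ?thesis by simp
qed

text \<open>A debtor has at most two neighbours in the set, but surviving three rounds would give it
  three.\<close>

lemma debtors_thrice: "debtors (grow (grow (grow hubs))) = {}"
proof (rule ccontr)
  assume "debtors (grow (grow (grow hubs))) \<noteq> {}"
  then obtain p where p: "p \<in> debtors (grow (grow (grow hubs)))" by auto
  note sub = subset_grow[of hubs] subset_grow[of "grow hubs"]
  have *: "hubs \<subseteq> grow hubs" "hubs \<subseteq> grow (grow hubs)" using sub by auto
  note 3 = debtors_grow[OF *(2) p]
  note 2 = debtors_grow[OF *(1) conjunct1[OF 3]]
  note 1 = debtors_grow[OF order_refl conjunct1[OF 2]]
  have "3 \<le> card (nb p \<inter> grow (grow (grow hubs)))" using 1 2 3 by linarith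
  then show False using p by (auto simp: debtors_def)
qed

section \<open>Discharging and the lower bound\<close>

text \<open>The creditor \<open>c\<close> is a neighbour of \<open>u\<close> private from its hub
  \<open>h\<close>; it avoids \<open>H\<close> because \<open>h\<close> is the only neighbour of
  \<open>u\<close> there.\<close>

lemma poor_has_creditor:
  assumes H: "hubs \<subseteq> H" and u: "u \<in> V - H" "card (nb u) + card (nb u \<inter> H) < 6"
  shows "u \<in> poor H major \<and> card (nb u) + card (nb u \<inter> H) = 5 \<and>
    (\<exists>c \<in> V - H. u \<in> nb c \<inter> poor H (major - nb c))"
proof -
  have d4: "4 \<le> card (nb u)" using four_le_degree u by auto
  have hub: "nb u \<inter> hubs \<noteq> {}"
    using no_hub_degree[of u] u by auto
  then have "nb u \<inter> H \<noteq> {}" using H by auto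
  then have "card (nb u \<inter> H) > 0" by (simp add: card_gt_0_iff)
  then have d: "card (nb u) = 4" "card (nb u \<inter> H) = 1" using d4 u(2) by linarith+
  then obtain h where h: "nb u \<inter> H = {h}" using card_1_singletonE by metis
  then have hh: "h \<in> nb u" "h \<in> V" "nb u \<inter> hubs = {h}" using hub H nb_subset[of u] by auto
  have "card V \<le> (\<Sum>y\<in>nb u. card (nb y))" using nb_dominates u by auto
  also have "\<dots> = card (nb h) + (\<Sum>y\<in>nb u - {h}. card (nb y))"
    using hh by (simp add: sum.remove)
  also have "(\<Sum>y\<in>nb u - {h}. card (nb y)) \<le> (\<Sum>y\<in>nb u - {h}. k)"
    using hh nb_subset[of u] degree_nonhub by (intro sum_mono) (blast intro: less_imp_le)
  also have "\<dots> = 3 * k" using hh d by simp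
  finally have major: "h \<in> major" using hh by (simp add: major_def)
  then have poor: "u \<in> poor H major" using u d h by (auto simp: poor_def)
  have "u \<noteq> h" using hh by auto
  then obtain c where c: "c \<in> nb u" "c \<noteq> h" "c \<notin> nb h"
    using private_nb[of u h] u hh by blast
  then have "c \<in> V - H" using h nb_subset[of u] by auto
  moreover have "u \<in> nb c" "h \<notin> nb c" using c nb_sym by auto
  then have "u \<in> nb c \<inter> poor H (major - nb c)" using u d h major by (auto simp: poor_def)
  ultimately show ?thesis using poor d by auto
qed

lemma no_debtors_bound:
  assumes H: "hubs \<subseteq> H" "H \<subseteq> V" and nodebt: "debtors H = {}"
  shows "3 * card V \<le> card E + 3 * card H"
proof -
  let ?L = "V - H"
  let ?U = "{u \<in> ?L. card (nb u) + card (nb u \<inter> H) < 6}"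
  let ?D = "\<lambda>x. nb x \<inter> poor H (major - nb x)"
  have "card ?U \<le> card (\<Union>x\<in>?L. ?D x)"
    using poor_has_creditor[OF H(1)] by (intro card_mono) auto
  also have "\<dots> \<le> (\<Sum>x\<in>?L. card (?D x))" by (rule card_UN_le) simp
  finally have "6 * card ?L + card ?U \<le> (\<Sum>x\<in>?L. 6 + card (?D x))"
    by (simp add: sum.distrib)
  \<comment> \<open>The indicator restores the unit missing at a deficient vertex; summed, it
    cancels the \<open>card ?U\<close> on the left.\<close>
  also have "\<dots> \<le> (\<Sum>x\<in>?L. card (nb x) + card (nb x \<inter> H) + (if x \<in> ?U then 1 else 0))"
  proof (rule sum_mono)
    fix x assume x: "x \<in> ?L"
    show "6 + card (?D x) \<le> card (nb x) + card (nb x \<inter> H) + (if x \<in> ?U then 1 else 0)"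
    proof (cases "?D x = {}")
      case True
      show ?thesis
      proof (cases "x \<in> ?U")
        case True
        then show ?thesis using poor_has_creditor[OF H(1), of x] \<open>?D x = {}\<close> by simp
      next
        case False
        then have "6 \<le> card (nb x) + card (nb x \<inter> H)" using x by simp
        then show ?thesis unfolding True by simp
      qed
    next
      case False
      \<comment> \<open>Since \<open>x\<close> is no debtor, this bound holds; adding its neighbours
        in \<open>?D x\<close> to both sides turns the right side into degree plus degree into
        \<open>H\<close>.\<close>
      have "6 \<le> 2 * card (nb x \<inter> H) + card (nb x - H - poor H (major - nb x))"
        using nodebt False x by (force simp: debtors_def)
      moreover have "card (nb x) = card (nb x \<inter> H) + card (nb x - H)"
        by (metis card_Int_Diff finite_nb)
      moreover have "card (nb x - H) = card ((nb x - H) \<inter> poor H (major - nb x)) + card (nb x - H - poor H (major - nb x))"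
        by (rule card_Int_Diff) simp
      moreover have "(nb x - H) \<inter> poor H (major - nb x) = ?D x"
        using poor_subset[of H "major - nb x"] by auto
      ultimately show ?thesis by simp
    qed
  qed
  also have "\<dots> = (\<Sum>x\<in>?L. card (nb x) + card (nb x \<inter> H)) + card ?U"
    by (simp add: sum.distrib sum.inter_filter[symmetric])
  finally have "6 * card ?L \<le> 2 * card E" using edge_bound[OF H(2)] by linarith
  moreover have "card V = card ?L + card H"
    using H by (metis card_Diff_subset card_mono finite_V finite_subset le_add_diff_inverse2)
  ultimately show ?thesis by linarith
qed

lemma edges_lower: "3 * card V \<le> card E + 1764"
proof -
  let ?H = "grow (grow (grow hubs))"
  \<comment> \<open>Here \<open>588 = 84 + 3 * 168\<close>, and
    \<open>1764 = 3 * 588\<close>.\<close>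
  have "card ?H \<le> 588"
    using card_hubs card_grow[of hubs] card_grow[of "grow hubs"] card_grow[of "grow (grow hubs)"]
    by linarith
  moreover have "hubs \<subseteq> ?H"
    using subset_grow[of hubs] subset_grow[of "grow hubs"] subset_grow[of "grow (grow hubs)"] by blast
  moreover have "?H \<subseteq> V"
    using hubs_subset by (intro grow_subset)
  ultimately show ?thesis
    using no_debtors_bound[of ?H, OF _ _ debtors_thrice] by linarith
qed

end

lemma ec2_edges_lower:
  fixes V :: "'a set"
  assumes "simple_graph V E" "existentially_closed 2 V E" "200 \<le> card V"
  shows "3 * card V \<le> card E + 1764"
proof (cases "card E < 3 * card V")
  case True
  interpret sparse_ec2_graph V E
    using assms True by unfold_locales auto
  show ?thesis by (rule edges_lower)
qed simp

section \<open>Upper bound: three hubs and a coloured cycle\<close>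

text \<open>
  The alternating pattern \<open>0, 0, 1, 1\<close> is closed up with \<open>2, 2\<close> for any cycle length; positions 4 and
  22 provide further, mutually distant, vertices of colour 2.
\<close>

definition colour :: "nat \<Rightarrow> nat \<Rightarrow> nat" where
  "colour n i = (if i = 4 \<or> i = 22 \<or> n \<le> i + 2 then 2 else i div 2 mod 2)"

definition cyc_succ :: "nat \<Rightarrow> nat \<Rightarrow> nat" where
  "cyc_succ n i = (if i + 1 = n then 0 else i + 1)"

text \<open>Vertex \<open>n + j\<close> is the hub of colour \<open>j\<close>. Each cycle vertex
  contributes three edges, so the edge count is immediate.\<close>

definition hub_cycle_edges :: "nat \<Rightarrow> nat set set" where
  "hub_cycle_edges n = (\<Union>i<n. {{i, cyc_succ n i}, {i, n + (colour n i + 1) mod 3}, {i, n + (colour n i + 2) mod 3}})"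

definition hub_cycle_adj :: "nat \<Rightarrow> nat \<Rightarrow> nat \<Rightarrow> bool" where
  "hub_cycle_adj n x y \<longleftrightarrow>
     x < n \<and> y < n \<and> (y = cyc_succ n x \<or> x = cyc_succ n y) \<or>
     x < n \<and> (\<exists>j<3. y = n + j \<and> j \<noteq> colour n x) \<or>
     y < n \<and> (\<exists>j<3. x = n + j \<and> j \<noteq> colour n y)"

lemma colour_less: "colour n i < 3"
  using mod_less_divisor[of 2 "i div 2"] by (simp add: colour_def less_SucI del: mod_less_divisor)

lemma other_colours:
  fixes c j :: nat
  assumes "c < 3"
  shows "j < 3 \<and> j \<noteq> c \<longleftrightarrow> j = (c + 1) mod 3 \<or> j = (c + 2) mod 3"
proof -
  have "c = 0 \<or> c = 1 \<or> c = 2" using assms by auto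
  then show ?thesis by auto
qed

lemma cyc_succ_less: "i < n \<Longrightarrow> cyc_succ n i < n"
  by (auto simp: cyc_succ_def)

lemma cyc_succ_inj: "i < n \<Longrightarrow> j < n \<Longrightarrow> cyc_succ n i = cyc_succ n j \<longleftrightarrow> i = j"
  by (auto simp: cyc_succ_def)

lemma cyc_pred:
  assumes "i < n"
  obtains p where "p < n" "cyc_succ n p = i"
proof (cases i)
  case 0
  with assms that[of "n - 1"] show ?thesis by (simp add: cyc_succ_def)
next
  case (Suc m)
  with assms that[of m] show ?thesis by (simp add: cyc_succ_def)
qed

lemma hub_cycle_edge_iff: "{x, y} \<in> hub_cycle_edges n \<longleftrightarrow> hub_cycle_adj n x y"
proof -
  have "{x, y} \<in> hub_cycle_edges n \<longleftrightarrow>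
      x < n \<and> (y = cyc_succ n x \<or> y = n + (colour n x + 1) mod 3 \<or> y = n + (colour n x + 2) mod 3) \<or>
      y < n \<and> (x = cyc_succ n y \<or> x = n + (colour n y + 1) mod 3 \<or> x = n + (colour n y + 2) mod 3)"
    unfolding hub_cycle_edges_def by (auto simp: doubleton_eq_iff)
  also have "\<dots> \<longleftrightarrow> hub_cycle_adj n x y"
    using other_colours[OF colour_less[of n x]] other_colours[OF colour_less[of n y]]
    unfolding hub_cycle_adj_def by (metis cyc_succ_less)
  finally show ?thesis .
qed

lemma hub_cycle_adj_low:
  "x < n \<Longrightarrow> y < n \<Longrightarrow> hub_cycle_adj n x y \<longleftrightarrow> y = cyc_succ n x \<or> x = cyc_succ n y"
  by (auto simp: hub_cycle_adj_def)

lemma hub_cycle_adj_low_hub: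
  "x < n \<Longrightarrow> j < 3 \<Longrightarrow> hub_cycle_adj n x (n + j) \<longleftrightarrow> j \<noteq> colour n x"
  "x < n \<Longrightarrow> j < 3 \<Longrightarrow> hub_cycle_adj n (n + j) x \<longleftrightarrow> j \<noteq> colour n x"
  by (auto simp: hub_cycle_adj_def)

lemma hub_cycle_adj_hubs: "\<not> hub_cycle_adj n (n + i) (n + j)"
  by (auto simp: hub_cycle_adj_def)

lemmas hub_cycle_adj_simps = hub_cycle_adj_low hub_cycle_adj_low_hub hub_cycle_adj_hubs

context
  fixes n :: nat
  assumes n: "100 \<le> n"
begin

text \<open>Adding 2 to \<open>i\<close> flips the parity of \<open>i div 2\<close>, and no two
  positions of colour 2 are at distance two on the cycle.\<close>

lemma colour_succ_succ:
  assumes "i < n"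
  shows "colour n (cyc_succ n (cyc_succ n i)) \<noteq> colour n i"
proof -
  consider "i + 2 < n" | "n = i + 2" | "n = i + 1" using assms by linarith
  then show ?thesis
  proof cases
    case 1
    then have "cyc_succ n (cyc_succ n i) = i + 2" by (simp add: cyc_succ_def)
    moreover have "(i + 2) div 2 mod 2 \<noteq> i div 2 mod 2" by presburger
    moreover have "i div 2 mod 2 \<noteq> 2" "(i + 2) div 2 mod 2 \<noteq> 2" by presburger+
    ultimately show ?thesis using n 1 by (simp add: colour_def)
  next
    case 2
    then have "cyc_succ n (cyc_succ n i) = 0" using n by (simp add: cyc_succ_def)
    then show ?thesis using n 2 by (simp add: colour_def)
  next
    case 3
    then have "cyc_succ n (cyc_succ n i) = 1" using n by (simp add: cyc_succ_def)
    then show ?thesis using n 3 by (simp add: colour_def)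
  qed
qed

text \<open>Each colour has two candidates at least 8 apart, so \<open>x\<close> and its cycle
  neighbours cannot spoil both.\<close>

lemma colour_witness:
  assumes "x < n" "j < 3"
  obtains z where "z < n" "colour n z = j" "z \<noteq> x" "\<not> hub_cycle_adj n z x"
proof -
  have far: "z \<noteq> x \<and> \<not> hub_cycle_adj n z x" if "z \<noteq> x" "z + 1 \<noteq> x" "z \<noteq> x + 1" "0 < z" "z < 50" for z
    using that assms n by (simp add: hub_cycle_adj_low cyc_succ_def)
  have w: "colour n z = j \<Longrightarrow> z < 50 \<Longrightarrow> 0 < z \<Longrightarrow> z \<noteq> x \<Longrightarrow> z + 1 \<noteq> x \<Longrightarrow> z \<noteq> x + 1 \<Longrightarrow> thesis" for z
    using that[of z] far[of z] n by simp
  have "j = 0 \<or> j = 1 \<or> j = 2" using assms by auto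
  moreover have "colour n 8 = 0" "colour n 16 = 0" "colour n 10 = 1" "colour n 18 = 1"
    "colour n 4 = 2" "colour n 22 = 2"
    using n by (simp_all add: colour_def)
  ultimately show thesis
    using w[of 8] w[of 16] w[of 10] w[of 18] w[of 4] w[of 22]
    by (cases "x < 13") auto
qed

lemma hub_cycle_low_low:
  assumes "x < n" "y < n" "x \<noteq> y"
  shows "\<exists>z<n + 3. hub_cycle_adj n z x \<and> hub_cycle_adj n z y"
    and "\<exists>z<n + 3. z \<noteq> y \<and> hub_cycle_adj n z x \<and> \<not> hub_cycle_adj n z y"
    and "\<exists>z<n + 3. z \<noteq> x \<and> z \<noteq> y \<and> \<not> hub_cycle_adj n z x \<and> \<not> hub_cycle_adj n z y"
proof -
  \<comment> \<open>A hub whose colour is neither that of \<open>x\<close> nor that of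
    \<open>y\<close> is adjacent to both.\<close>
  have "\<exists>j<3. j \<noteq> colour n x \<and> j \<noteq> colour n y" by presburger
  then obtain j where "j < 3" "j \<noteq> colour n x" "j \<noteq> colour n y" by blast
  then show "\<exists>z<n + 3. hub_cycle_adj n z x \<and> hub_cycle_adj n z y"
    using assms by (intro exI[of _ "n + j"]) (simp add: hub_cycle_adj_simps)
  show "\<exists>z<n + 3. z \<noteq> y \<and> hub_cycle_adj n z x \<and> \<not> hub_cycle_adj n z y"
  proof (cases "colour n x = colour n y")
    case False
    then show ?thesis using assms colour_less[of n y]
      by (intro exI[of _ "n + colour n y"]) (simp add: hub_cycle_adj_simps)
  next
    case True
    show ?thesis
    proof (cases "y = cyc_succ n x")
      case False
      \<comment> \<open>Equal colours rule out distance two, so the successor of \<open>x\<close> is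
        not adjacent to \<open>y\<close>.\<close>
      have "y \<noteq> cyc_succ n (cyc_succ n x)" using True colour_succ_succ[OF assms(1)] by auto
      then show ?thesis using assms False cyc_succ_less[OF assms(1)] cyc_succ_inj[of x n y]
        by (intro exI[of _ "cyc_succ n x"]) (auto simp: hub_cycle_adj_low)
    next
      case y: True
      obtain p where p: "p < n" "cyc_succ n p = x" using cyc_pred[OF assms(1)] .
      then have "p \<noteq> y \<and> y \<noteq> cyc_succ n p \<and> p \<noteq> cyc_succ n y"
        using y n by (auto simp: cyc_succ_def split: if_splits)
      then show ?thesis using p assms by (intro exI[of _ p]) (auto simp: hub_cycle_adj_low)
    qed
  qed
  have far: "z \<noteq> w \<and> \<not> hub_cycle_adj n z w" if "w < n" "z \<noteq> w" "z + 1 \<noteq> w" "z \<noteq> w + 1" "0 < z" "z < 50" for z w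
    using that n by (simp add: hub_cycle_adj_low cyc_succ_def)
  \<comment> \<open>The candidates are 4 apart, so each of \<open>x\<close> and \<open>y\<close>
    excludes at most one of the three.\<close>
  have "\<exists>z\<in>{8, 12, 16}. z \<noteq> x \<and> z + 1 \<noteq> x \<and> z \<noteq> x + 1 \<and> z \<noteq> y \<and> z + 1 \<noteq> y \<and> z \<noteq> y + 1"
    by auto
  then obtain z where "z \<in> {8, 12, 16}" "z \<noteq> x" "z + 1 \<noteq> x" "z \<noteq> x + 1" "z \<noteq> y" "z + 1 \<noteq> y" "z \<noteq> y + 1"
    by blast
  then show "\<exists>z<n + 3. z \<noteq> x \<and> z \<noteq> y \<and> \<not> hub_cycle_adj n z x \<and> \<not> hub_cycle_adj n z y"
    using far[of x z] far[of y z] assms n by (intro exI[of _ z]) auto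
qed

lemma hub_cycle_low_hub:
  assumes x: "x < n" and j: "j < 3"
  shows "\<exists>z<n + 3. hub_cycle_adj n z x \<and> hub_cycle_adj n z (n + j)"
    and "\<exists>z<n + 3. z \<noteq> n + j \<and> hub_cycle_adj n z x \<and> \<not> hub_cycle_adj n z (n + j)"
    and "\<exists>z<n + 3. z \<noteq> x \<and> hub_cycle_adj n z (n + j) \<and> \<not> hub_cycle_adj n z x"
    and "\<exists>z<n + 3. z \<noteq> x \<and> z \<noteq> n + j \<and> \<not> hub_cycle_adj n z x \<and> \<not> hub_cycle_adj n z (n + j)"
proof -
  obtain p where p: "p < n" "cyc_succ n p = x" using cyc_pred[OF x] .
  let ?s = "cyc_succ n x"
  \<comment> \<open>The two cycle neighbours of \<open>x\<close> are at distance two, hence differ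
    in colour, and one of them is adjacent to the hub \<open>n + j\<close>.\<close>
  have "colour n p \<noteq> colour n ?s" using colour_succ_succ[OF p(1)] p by auto
  then have "colour n p \<noteq> j \<or> colour n ?s \<noteq> j" by auto
  then show "\<exists>z<n + 3. hub_cycle_adj n z x \<and> hub_cycle_adj n z (n + j)"
  proof
    assume "colour n p \<noteq> j"
    then show ?thesis using p x j by (intro exI[of _ p]) (auto simp: hub_cycle_adj_simps)
  next
    assume "colour n ?s \<noteq> j"
    then show ?thesis using cyc_succ_less[OF x] x j
      by (intro exI[of _ ?s]) (auto simp: hub_cycle_adj_simps)
  qed
  have "\<exists>i<3. i \<noteq> colour n x \<and> i \<noteq> j" by presburger
  then obtain i where "i < 3" "i \<noteq> colour n x" "i \<noteq> j" by blast
  then show "\<exists>z<n + 3. z \<noteq> n + j \<and> hub_cycle_adj n z x \<and> \<not> hub_cycle_adj n z (n + j)"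
    using x by (intro exI[of _ "n + i"]) (simp add: hub_cycle_adj_simps)
  have "\<exists>i<3. i \<noteq> j" by presburger
  then obtain i where i: "i < 3" "i \<noteq> j" by blast
  obtain z where "z < n" "colour n z = i" "z \<noteq> x" "\<not> hub_cycle_adj n z x"
    using colour_witness[OF x i(1)] .
  then show "\<exists>z<n + 3. z \<noteq> x \<and> hub_cycle_adj n z (n + j) \<and> \<not> hub_cycle_adj n z x"
    using i j by (intro exI[of _ z]) (simp add: hub_cycle_adj_low_hub)
  obtain z where "z < n" "colour n z = j" "z \<noteq> x" "\<not> hub_cycle_adj n z x"
    using colour_witness[OF x j] .
  then show "\<exists>z<n + 3. z \<noteq> x \<and> z \<noteq> n + j \<and> \<not> hub_cycle_adj n z x \<and> \<not> hub_cycle_adj n z (n + j)"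
    using j by (intro exI[of _ z]) (simp add: hub_cycle_adj_low_hub)
qed

text \<open>A cycle vertex of the third colour is adjacent to both hubs, one of colour
  \<open>j\<close> only to the first, and the third hub to neither.\<close>

lemma hub_cycle_hub_hub:
  assumes "i < 3" "j < 3" "i \<noteq> j"
  shows "\<exists>z<n + 3. hub_cycle_adj n z (n + i) \<and> hub_cycle_adj n z (n + j)"
    and "\<exists>z<n + 3. z \<noteq> n + j \<and> hub_cycle_adj n z (n + i) \<and> \<not> hub_cycle_adj n z (n + j)"
    and "\<exists>z<n + 3. z \<noteq> n + i \<and> z \<noteq> n + j \<and> \<not> hub_cycle_adj n z (n + i) \<and> \<not> hub_cycle_adj n z (n + j)"
proof -
  have low: "\<exists>z<n. colour n z = c" if "c < 3" for c
    using colour_witness[of 0 c] that n by auto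
  have "\<exists>c<3. c \<noteq> i \<and> c \<noteq> j" by presburger
  then obtain c where c: "c < 3" "c \<noteq> i" "c \<noteq> j" by blast
  obtain z where "z < n" "colour n z = c" using low[OF c(1)] by blast
  then show "\<exists>z<n + 3. hub_cycle_adj n z (n + i) \<and> hub_cycle_adj n z (n + j)"
    using c assms by (intro exI[of _ z]) (simp add: hub_cycle_adj_simps)
  obtain z where "z < n" "colour n z = j" using low[OF assms(2)] by blast
  then show "\<exists>z<n + 3. z \<noteq> n + j \<and> hub_cycle_adj n z (n + i) \<and> \<not> hub_cycle_adj n z (n + j)"
    using assms by (intro exI[of _ z]) (simp add: hub_cycle_adj_simps)
  show "\<exists>z<n + 3. z \<noteq> n + i \<and> z \<noteq> n + j \<and> \<not> hub_cycle_adj n z (n + i) \<and> \<not> hub_cycle_adj n z (n + j)"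
    using c by (intro exI[of _ "n + c"]) (simp add: hub_cycle_adj_hubs)
qed

lemma hub_number:
  assumes "x < n + 3" "\<not> x < n"
  shows "\<exists>j<3. x = n + j"
  using assms by (intro exI[of _ "x - n"]) simp

lemma hub_cycle_adj_common:
  assumes "x < n + 3" "y < n + 3" "x \<noteq> y"
  shows "\<exists>z<n + 3. hub_cycle_adj n z x \<and> hub_cycle_adj n z y"
proof (cases "x < n"; cases "y < n")
  assume "x < n" "y < n"
  then show ?thesis using assms(3) by (rule hub_cycle_low_low(1))
next
  assume xy: "x < n" "\<not> y < n"
  then obtain j where "j < 3" "y = n + j" using hub_number assms(2) by blast
  then show ?thesis using hub_cycle_low_hub(1)[OF xy(1)] by blast
next
  assume xy: "\<not> x < n" "y < n"
  then obtain j where "j < 3" "x = n + j" using hub_number assms(1) by blast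
  then show ?thesis using hub_cycle_low_hub(1)[OF xy(2)] by blast
next
  assume "\<not> x < n" "\<not> y < n"
  then obtain i j where "i < 3" "x = n + i" "j < 3" "y = n + j"
    using hub_number assms(1,2) by metis
  then show ?thesis using hub_cycle_hub_hub(1) assms(3) by blast
qed

lemma hub_cycle_adj_private:
  assumes "x < n + 3" "y < n + 3" "x \<noteq> y"
  shows "\<exists>z<n + 3. z \<noteq> y \<and> hub_cycle_adj n z x \<and> \<not> hub_cycle_adj n z y"
proof (cases "x < n"; cases "y < n")
  assume "x < n" "y < n"
  then show ?thesis using assms(3) by (rule hub_cycle_low_low(2))
next
  assume xy: "x < n" "\<not> y < n"
  then obtain j where "j < 3" "y = n + j" using hub_number assms(2) by blast
  then show ?thesis using hub_cycle_low_hub(2)[OF xy(1)] by blast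
next
  assume xy: "\<not> x < n" "y < n"
  then obtain j where "j < 3" "x = n + j" using hub_number assms(1) by blast
  then show ?thesis using hub_cycle_low_hub(3)[OF xy(2)] by blast
next
  assume "\<not> x < n" "\<not> y < n"
  then obtain i j where "i < 3" "x = n + i" "j < 3" "y = n + j"
    using hub_number assms(1,2) by metis
  then show ?thesis using hub_cycle_hub_hub(2) assms(3) by blast
qed

lemma hub_cycle_adj_neither:
  assumes "x < n + 3" "y < n + 3" "x \<noteq> y"
  shows "\<exists>z<n + 3. z \<noteq> x \<and> z \<noteq> y \<and> \<not> hub_cycle_adj n z x \<and> \<not> hub_cycle_adj n z y"
proof (cases "x < n"; cases "y < n")
  assume "x < n" "y < n"
  then show ?thesis using assms(3) by (rule hub_cycle_low_low(3))
next
  assume xy: "x < n" "\<not> y < n"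
  then obtain j where "j < 3" "y = n + j" using hub_number assms(2) by blast
  then show ?thesis using hub_cycle_low_hub(4)[OF xy(1)] by blast
next
  assume xy: "\<not> x < n" "y < n"
  then obtain j where "j < 3" "x = n + j" using hub_number assms(1) by blast
  then show ?thesis using hub_cycle_low_hub(4)[OF xy(2)] by blast
next
  assume "\<not> x < n" "\<not> y < n"
  then obtain i j where "i < 3" "x = n + i" "j < 3" "y = n + j"
    using hub_number assms(1,2) by metis
  then show ?thesis using hub_cycle_hub_hub(3) assms(3) by blast
qed

lemma hub_cycle_adj_irrefl: "\<not> hub_cycle_adj n x x"
  using n by (auto simp: hub_cycle_adj_def cyc_succ_def)

lemma hub_cycle_simple: "simple_graph {..<n + 3} (hub_cycle_edges n)"
  unfolding simple_graph_def
proof (intro conjI subsetI CollectI)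
  fix e assume e: "e \<in> hub_cycle_edges n"
  then obtain x y where xy: "e = {x, y}" by (auto simp: hub_cycle_edges_def)
  with e have adj: "hub_cycle_adj n x y" by (simp add: hub_cycle_edge_iff)
  then show "z \<in> {..<n + 3}" if "z \<in> e" for z
    using that xy by (auto simp: hub_cycle_adj_def)
  have "x \<noteq> y" using adj hub_cycle_adj_irrefl by auto
  then show "card e = 2" using xy by simp
qed simp

lemma hub_cycle_ec2: "existentially_closed 2 {..<n + 3} (hub_cycle_edges n)"
  unfolding existentially_closed_def hub_cycle_edge_iff
proof (intro allI impI)
  fix S A B :: "nat set"
  assume *: "S \<subseteq> {..<n + 3} \<and> card S = 2 \<and> A \<union> B = S \<and> A \<inter> B = {}"
  then obtain x y where S: "S = {x, y}" "x \<noteq> y" by (auto simp: card_2_iff)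
  have xy: "x < n + 3" "y < n + 3" "y \<noteq> x" using * S by auto
  have B: "B = S - A" and A: "A \<subseteq> {x, y}" using * S by auto
  have "\<exists>z<n + 3. z \<notin> S \<and> (\<forall>a\<in>A. hub_cycle_adj n z a) \<and> (\<forall>b\<in>S - A. \<not> hub_cycle_adj n z b)"
  proof -
    consider "A = {x, y}" | "A = {x}" | "A = {y}" | "A = {}" using A by blast
    then show ?thesis
    proof cases
      case 1
      then show ?thesis using hub_cycle_adj_common[OF xy(1,2) S(2)] S hub_cycle_adj_irrefl by auto
    next
      case 2
      then have "S - A = {y}" using S by auto
      then show ?thesis using 2 hub_cycle_adj_private[OF xy(1,2) S(2)] S hub_cycle_adj_irrefl by auto
    next
      case 3
      then have "S - A = {x}" using S by auto
      then show ?thesis using 3 hub_cycle_adj_private[OF xy(2,1,3)] S hub_cycle_adj_irrefl by auto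
    next
      case 4
      then show ?thesis using hub_cycle_adj_neither[OF xy(1,2) S(2)] S by auto
    qed
  qed
  then show "\<exists>z\<in>{..<n + 3} - S. (\<forall>a\<in>A. hub_cycle_adj n z a) \<and> (\<forall>b\<in>B. \<not> hub_cycle_adj n z b)"
    unfolding B by auto
qed

end

lemma card_hub_cycle_edges: "card (hub_cycle_edges n) \<le> 3 * n"
proof -
  have "card (hub_cycle_edges n) \<le> (\<Sum>i<n. card {{i, cyc_succ n i}, {i, n + (colour n i + 1) mod 3}, {i, n + (colour n i + 2) mod 3}})"
    unfolding hub_cycle_edges_def by (rule card_UN_le) simp
  also have "\<dots> \<le> (\<Sum>i<n. 3)"
    by (intro sum_mono) (simp add: card_insert_if)
  finally show ?thesis by simp
qed

theorem theorem3:
  fixes v :: nat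
  assumes "v \<ge> 3201"
  shows "enat (3 * v - 5625) \<le> min_ec_edges v 2 \<and> min_ec_edges v 2 \<le> enat (3 * v + 25)"
proof
  show "enat (3 * v - 5625) \<le> min_ec_edges v 2"
    unfolding min_ec_edges_def
  proof (rule Inf_greatest, clarify)
    fix V :: "nat set" and E
    assume "simple_graph V E" "existentially_closed 2 V E" "v = card V"
    then show "enat (3 * card V - 5625) \<le> enat (card E)"
      using ec2_edges_lower[of V E] assms by simp
  qed
next
  define n where "n = v - 3"
  have n: "100 \<le> n" "v = n + 3" using assms by (auto simp: n_def)
  have "min_ec_edges v 2 \<le> enat (card (hub_cycle_edges n))"
    unfolding min_ec_edges_def
    using hub_cycle_simple[OF n(1)] hub_cycle_ec2[OF n(1)] n(2)
    by (intro Inf_lower CollectI exI[of _ "{..<n + 3}"] exI[of _ "hub_cycle_edges n"]) simp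
  also have "\<dots> \<le> enat (3 * v + 25)"
    using card_hub_cycle_edges[of n] n(2) by simp
  finally show "min_ec_edges v 2 \<le> enat (3 * v + 25)" .
qed

end
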